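(* Let $p>2$ be a prime and let $A\in GL_2(\mathbb{F}_p)$ be a semisimple matrix with distinct eigenvalues $\lambda_1\neq\lambda_2$, at least one of which, say $\lambda_i$ with $i\in\{1,2\}$, lies in $\mathbb{F}_{p^2}\setminus\mathbb{F}_p$. Then there exists $B\in GL_2(\mathbb{F}_p)$ with $B^2=A$ if and only if $\lambda_i$ is a square in the quadratic extension $\mathbb{F}_{p^2}$.
   Context: A matrix is semisimple if its minimal polynomial is a product of distinct monic irreducible separable polynomials. *)

theory Defs
  imports
    "HOL-Algebra.Algebraic_Closure_Type"
    "Jordan_Normal_Form.Char_Poly"
    "Berlekamp_Zassenhaus.Finite_Field"
begin

definition GL :: "nat \<Rightarrow> 'a::semiring_1 mat set" where
  "GL n = {A \<in> carrier_mat n n. invertible_mat A}"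

definition mat_poly :: "'a::comm_ring_1 poly \<Rightarrow> 'a mat \<Rightarrow> 'a mat" where
  "mat_poly f A =
     mat (dim_row A) (dim_row A) (\<lambda>(i, j). \<Sum>k\<le>degree f. coeff f k * (A ^\<^sub>m k) $$ (i, j))"

definition is_min_poly :: "'a::field mat \<Rightarrow> 'a poly \<Rightarrow> bool" where
  "is_min_poly A f \<longleftrightarrow>
     lead_coeff f = 1 \<and> mat_poly f A = 0\<^sub>m (dim_row A) (dim_row A) \<and>
     (\<forall>g. g \<noteq> 0 \<and> mat_poly g A = 0\<^sub>m (dim_row A) (dim_row A) \<longrightarrow> degree f \<le> degree g)"

(* No repeated roots in an algebraic closure.  Squarefreeness over 'a itself would be weaker:
   rsquarefree only looks at roots in the coefficient ring. *)
definition separable_poly :: "'a::field poly \<Rightarrow> bool" where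
  "separable_poly f \<longleftrightarrow> rsquarefree (map_poly to_ac f)"

(* The factors are collected in a set, so they are pairwise distinct. *)
definition semisimple_mat :: "'a::field mat \<Rightarrow> bool" where
  "semisimple_mat A \<longleftrightarrow>
     (\<exists>f S. is_min_poly A f \<and> finite S \<and>
        (\<forall>q\<in>S. lead_coeff q = 1 \<and> irreducible q \<and> separable_poly q) \<and> f = \<Prod>S)"

end

theory Submission
  imports Defs
begin

text \<open>
  Write \<open>t\<close> and \<open>D\<close> for the trace and the determinant of \<open>A\<close>, so that \<open>\<lambda>\<^sup>2 = t \<lambda> - D\<close> and, by
  Cayley--Hamilton, \<open>A\<^sup>2 = t A - D\<close>. If \<open>B\<^sup>2 = A\<close> and \<open>B\<close> has trace \<open>s\<close> and determinant \<open>\<delta>\<close>, then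
  \<open>t = s\<^sup>2 - 2 \<delta>\<close> and \<open>D = \<delta>\<^sup>2\<close>, hence \<open>(\<lambda> + \<delta>)\<^sup>2 = s\<^sup>2 \<lambda>\<close>; here \<open>s \<noteq> 0\<close> because \<open>\<lambda>\<close> is not in the
  prime field, so \<open>(\<lambda> + \<delta>) / s\<close> is a square root of \<open>\<lambda>\<close>. Conversely, \<open>1\<close> and \<open>\<lambda>\<close> form a basis of
  the quadratic extension by counting, and a square root \<open>x + y \<lambda>\<close> of \<open>\<lambda>\<close> gives the square root
  \<open>x + y A\<close> of \<open>A\<close>, since both computations use only the relation above.
\<close>

definition trace2 :: "'a::comm_ring_1 mat \<Rightarrow> 'a" where
  "trace2 A = A $$ (0, 0) + A $$ (1, 1)"

definition det2 :: "'a::comm_ring_1 mat \<Rightarrow> 'a" where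
  "det2 A = A $$ (0, 0) * A $$ (1, 1) - A $$ (0, 1) * A $$ (1, 0)"

lemma mat_eq_2_iff:
  assumes "A \<in> carrier_mat 2 2" "B \<in> carrier_mat 2 2"
  shows "A = B \<longleftrightarrow> A $$ (0, 0) = B $$ (0, 0) \<and> A $$ (0, 1) = B $$ (0, 1) \<and>
    A $$ (1, 0) = B $$ (1, 0) \<and> A $$ (1, 1) = B $$ (1, 1)"
  using assms by (auto simp: mat_eq_iff less_2_cases_iff)

lemma pow_mat_2_index:
  assumes "B \<in> carrier_mat 2 2" "i < 2" "j < 2"
  shows "(B ^\<^sub>m 2) $$ (i, j) = B $$ (i, 0) * B $$ (0, j) + B $$ (i, 1) * B $$ (1, j)"
  using assms by (simp add: numeral_2_eq_2 scalar_prod_def)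

lemma trace2_pow_2:
  assumes "B \<in> carrier_mat 2 2"
  shows "trace2 (B ^\<^sub>m 2) = trace2 B ^ 2 - 2 * det2 B"
  unfolding trace2_def det2_def using assms
  by (simp add: pow_mat_2_index power2_eq_square algebra_simps)

lemma det2_pow_2:
  assumes "B \<in> carrier_mat 2 2"
  shows "det2 (B ^\<^sub>m 2) = det2 B ^ 2"
  unfolding det2_def using assms
  by (simp add: pow_mat_2_index power2_eq_square algebra_simps)

text \<open>By Cayley-Hamilton the square equals \<open>(x ^ 2 - y ^ 2 * det2 A)\<close> times the
  identity plus \<open>(2 * x * y + y ^ 2 * trace2 A)\<close> times \<open>A\<close>; the
  assumptions make these coefficients 0 and 1.\<close>

lemma pow_mat_2_linear_combination:
  fixes A :: "'a::comm_ring_1 mat"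
  assumes A: "A \<in> carrier_mat 2 2"
    and "x ^ 2 = y ^ 2 * det2 A" and "2 * x * y + y ^ 2 * trace2 A = 1"
  shows "(x \<cdot>\<^sub>m 1\<^sub>m 2 + y \<cdot>\<^sub>m A) ^\<^sub>m 2 = A"
proof -
  define a b c d where abcd: "a = A $$ (0, 0)" "b = A $$ (0, 1)" "c = A $$ (1, 0)" "d = A $$ (1, 1)"
  have h: "x * x = y * y * (a * d - b * c)" "2 * x * y + y * y * (a + d) = 1"
    using assms(2,3) by (simp_all add: det2_def trace2_def abcd power2_eq_square)
  \<comment> \<open>The four entries of the square, regrouped so that both sides of \<open>h\<close>
    appear literally; this replaces an appeal to Cayley-Hamilton.\<close>
  have "(x + y * a) * (x + y * a) + (y * b) * (y * c) =
      (x * x - y * y * (a * d - b * c)) + a * (2 * x * y + y * y * (a + d))"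
    "(x + y * a) * (y * b) + (y * b) * (x + y * d) = b * (2 * x * y + y * y * (a + d))"
    "(y * c) * (x + y * a) + (x + y * d) * (y * c) = c * (2 * x * y + y * y * (a + d))"
    "(y * c) * (y * b) + (x + y * d) * (x + y * d) =
      (x * x - y * y * (a * d - b * c)) + d * (2 * x * y + y * y * (a + d))"
    by (simp_all add: algebra_simps)
  note this[unfolded h, simplified]
  then show ?thesis
    using A by (subst mat_eq_2_iff) (auto simp: pow_mat_2_index abcd)
qed

text \<open>If \<open>C\<close> inverts \<open>B * B\<close>, then \<open>B * C\<close> is a right
  inverse of \<open>B\<close>, and a right inverse of a square matrix is two-sided.\<close>

lemma invertible_mat_sqrt:
  fixes B :: "'a::field mat"
  assumes B: "B \<in> carrier_mat n n" and "invertible_mat (B ^\<^sub>m 2)"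
  shows "invertible_mat B"
proof -
  obtain C where C: "B ^\<^sub>m 2 * C = 1\<^sub>m n" "C * B ^\<^sub>m 2 = 1\<^sub>m (dim_row C)"
    using assms by (auto simp: invertible_mat_def inverts_mat_def)
  have B2: "B ^\<^sub>m 2 = B * B"
    using B by (simp add: numeral_2_eq_2)
  \<comment> \<open>\<open>inverts_mat\<close> does not fix the dimensions of \<open>C\<close>; they
    are read off from the two products.\<close>
  have C': "C \<in> carrier_mat n n"
    using B arg_cong[OF C(1), of dim_col] arg_cong[OF C(2), of dim_col]
    by (auto simp: B2)
  have "B * (B * C) = 1\<^sub>m n"
    using C(1) B C' by (simp add: B2)
  moreover from this have "(B * C) * B = 1\<^sub>m n"
    using B C' by (intro mat_mult_left_right_inverse[of B n "B * C"]) auto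
  ultimately show ?thesis
    using B C' by (auto simp: invertible_mat_def inverts_mat_def)
qed

lemma eigenvalue_2_char_equation:
  fixes A :: "'a::field mat"
  assumes A: "A \<in> carrier_mat 2 2" and "eigenvalue A k"
  shows "k ^ 2 = trace2 A * k - det2 A"
proof -
  obtain v where v: "v \<in> carrier_vec 2" "v \<noteq> 0\<^sub>v 2" "A *\<^sub>v v = k \<cdot>\<^sub>v v"
    using assms by (auto simp: eigenvalue_def eigenvector_def)
  define a b c d x y where abcd: "a = A $$ (0, 0)" "b = A $$ (0, 1)" "c = A $$ (1, 0)"
    "d = A $$ (1, 1)" "x = v $ 0" "y = v $ 1"
  have "a * x + b * y = k * x" "c * x + d * y = k * y"
    using arg_cong[OF v(3), of "\<lambda>w. vec_index w 0"] arg_cong[OF v(3), of "\<lambda>w. vec_index w 1"] A v(1)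
    by (simp_all add: abcd scalar_prod_def numeral_2_eq_2)
  \<comment> \<open>The coefficients on the right are the rows of the adjugate of
    \<open>k - A\<close>, so both coordinates of \<open>v\<close> are annihilated by the determinant
    of \<open>k - A\<close>.\<close>
  moreover have "x * (k ^ 2 - (a + d) * k + (a * d - b * c)) =
      (k - d) * (k * x - (a * x + b * y)) + b * (k * y - (c * x + d * y))"
    "y * (k ^ 2 - (a + d) * k + (a * d - b * c)) =
      (k - a) * (k * y - (c * x + d * y)) + c * (k * x - (a * x + b * y))"
    by (simp_all add: power2_eq_square algebra_simps)
  ultimately have "x * (k ^ 2 - (a + d) * k + (a * d - b * c)) = 0"
    "y * (k ^ 2 - (a + d) * k + (a * d - b * c)) = 0"
    by simp_all
  moreover have "x \<noteq> 0 \<or> y \<noteq> 0"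
    using v(1,2) by (auto simp: abcd vec_eq_iff less_2_cases_iff)
  ultimately have "k ^ 2 - (a + d) * k + (a * d - b * c) = 0"
    by auto
  then show ?thesis
    by (simp add: trace2_def det2_def abcd algebra_simps)
qed

lemma eigenvalue_to_ac_2:
  assumes "A \<in> carrier_mat 2 2" and "eigenvalue (map_mat to_ac A) k"
  shows "k ^ 2 = to_ac (trace2 A) * k - to_ac (det2 A)"
  using eigenvalue_2_char_equation[of "map_mat to_ac A" k] assms
  by (simp add: trace2_def det2_def)

lemma subfield_type_algebraD:
  fixes K :: "'a::field set"
  assumes "subfield K ring_of_type_algebra"
  shows "0 \<in> K" "1 \<in> K" "x \<in> K \<Longrightarrow> y \<in> K \<Longrightarrow> x + y \<in> K"
    "x \<in> K \<Longrightarrow> y \<in> K \<Longrightarrow> x * y \<in> K"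
proof -
  note E = subringE[OF subfieldE(1)[OF assms]]
  show "0 \<in> K" "1 \<in> K" "x \<in> K \<Longrightarrow> y \<in> K \<Longrightarrow> x + y \<in> K"
    "x \<in> K \<Longrightarrow> y \<in> K \<Longrightarrow> x * y \<in> K"
    using E(2,3,6,7) by (simp_all add: ring_of_type_algebra_def)
qed

text \<open>Every element of the prime field is a sum of ones, hence lies in any subfield.\<close>

lemma to_ac_mod_ring_in_subfield:
  fixes z :: "'p::prime_card mod_ring"
  assumes "subfield K (ring_of_type_algebra :: 'p mod_ring alg_closure ring)"
  shows "to_ac z \<in> K"
proof -
  have "of_nat n \<in> K" for n
    by (induction n) (auto intro: subfield_type_algebraD[OF assms])
  moreover obtain n where "z = of_nat n"
  proof
    have "0 \<le> to_int_mod_ring z"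
      by transfer auto
    then show "z = of_nat (nat (to_int_mod_ring z))"
      by (simp add: of_nat_of_int_mod_ring)
  qed
  ultimately show ?thesis by simp
qed

lemma to_ac_linear_independent:
  assumes "k \<notin> range to_ac" and "to_ac x + to_ac y * k = to_ac x' + to_ac y' * k"
  shows "x = x' \<and> y = y'"
proof -
  have "y = y'"
  proof (rule ccontr)
    assume "y \<noteq> y'"
    then have "to_ac y - to_ac y' \<noteq> 0"
      by simp
    moreover have "(to_ac y - to_ac y') * k = to_ac x' - to_ac x"
      using assms(2) by (simp add: algebra_simps)
    ultimately have "k = to_ac ((x' - x) / (y - y'))"
      by (simp add: field_simps)
    with assms(1) show False by blast
  qed
  with assms(2) show ?thesis by simp
qed

lemma quadratic_extension_basis:
  fixes K :: "'p::prime_card mod_ring alg_closure set"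
  assumes K: "subfield K ring_of_type_algebra" and card: "card K = CARD('p) ^ 2"
    and k: "k \<in> K" "k \<notin> range to_ac" and "m \<in> K"
  obtains x y where "m = to_ac x + to_ac y * k"
proof -
  define \<phi> where "\<phi> = (\<lambda>(x, y). to_ac x + to_ac y * k :: 'p mod_ring alg_closure)"
  have "inj \<phi>"
    using to_ac_linear_independent[OF k(2)] by (auto simp: inj_def \<phi>_def)
  then have "card (range \<phi>) = card K"
    using card by (simp add: card_image power2_eq_square)
  moreover have "range \<phi> \<subseteq> K"
    using k(1) by (auto simp: \<phi>_def intro!: subfield_type_algebraD[OF K] to_ac_mod_ring_in_subfield[OF K])
  \<comment> \<open>An infinite set has \<open>card\<close> 0, so a positive cardinality forces
    finiteness.\<close>
  moreover have "finite K"
    using card by (intro card_ge_0_finite) simp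
  ultimately have "range \<phi> = K"
    by (simp add: card_subset_eq)
  with \<open>m \<in> K\<close> that show thesis
    by (auto simp: \<phi>_def)
qed

theorem theorem25:
  fixes p :: nat
    and A :: "'p::prime_card mod_ring mat"
    and K :: "'p mod_ring alg_closure set"
    and l :: "nat \<Rightarrow> 'p mod_ring alg_closure"
    and i :: nat
  assumes "p = CARD('p)" and "prime p" and "p > 2"
    and "subfield K ring_of_type_algebra" and "card K = p ^ 2"
    and "A \<in> GL 2" and "semisimple_mat A"
    and "eigenvalue (map_mat to_ac A) (l 1)" and "eigenvalue (map_mat to_ac A) (l 2)"
    and "l 1 \<noteq> l 2"
    and "i \<in> {1, 2}" and "l i \<in> K - range to_ac"
  shows "(\<exists>B \<in> GL 2. B ^\<^sub>m 2 = A) \<longleftrightarrow> (\<exists>m \<in> K. m ^ 2 = l i)"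
proof -
  note K = assms(4)
  define k where "k = l i"
  have kK: "k \<in> K" and kF: "k \<notin> range to_ac"
    using assms(12) by (auto simp: k_def)
  have A: "A \<in> carrier_mat 2 2" and "invertible_mat A"
    using assms(6) by (auto simp: GL_def)
  have "eigenvalue (map_mat to_ac A) k"
    using assms(8,9,11) by (auto simp: k_def)
  then have kk: "k ^ 2 = to_ac (trace2 A) * k - to_ac (det2 A)"
    by (rule eigenvalue_to_ac_2[OF A])
  show ?thesis unfolding k_def[symmetric]
  proof
    assume "\<exists>B \<in> GL 2. B ^\<^sub>m 2 = A"
    then obtain B where B: "B \<in> carrier_mat 2 2" and BA: "B ^\<^sub>m 2 = A"
      by (auto simp: GL_def)
    define s e where "s = trace2 B" and "e = det2 B"
    have "trace2 A = s ^ 2 - 2 * e" "det2 A = e ^ 2"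
      using trace2_pow_2[OF B] det2_pow_2[OF B] by (simp_all add: BA s_def e_def)
    with kk have "k ^ 2 = (to_ac s ^ 2 - 2 * to_ac e) * k - to_ac e ^ 2"
      by simp
    \<comment> \<open>Completing the square: the terms \<open>2 * e * k\<close> and
      \<open>e ^ 2\<close> move to the left.\<close>
    then have sq: "(k + to_ac e) ^ 2 = to_ac s ^ 2 * k"
      by (simp add: power2_eq_square algebra_simps)
    have "s \<noteq> 0"
    proof
      assume "s = 0"
      with sq have "k = to_ac (- e)"
        by (simp add: eq_neg_iff_add_eq_0)
      with kF show False by blast
    qed
    with sq have "((k + to_ac e) * to_ac (inverse s)) ^ 2 = k"
      by (simp add: power_mult_distrib field_simps)
    moreover have "(k + to_ac e) * to_ac (inverse s) \<in> K"
      by (intro subfield_type_algebraD[OF K] to_ac_mod_ring_in_subfield[OF K] kK)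
    ultimately show "\<exists>m \<in> K. m ^ 2 = k" by blast
  next
    assume "\<exists>m \<in> K. m ^ 2 = k"
    then obtain m where "m \<in> K" and m: "m ^ 2 = k" by blast
    then obtain x y where xy: "m = to_ac x + to_ac y * k"
      using quadratic_extension_basis[OF K _ kK kF] assms(1,5) by blast
    \<comment> \<open>Expand \<open>m ^ 2\<close>, reduce \<open>k ^ 2\<close> by \<open>kk\<close>,
      and compare coordinates with those of \<open>k\<close>, namely 0 and 1.\<close>
    have "to_ac (x ^ 2 - y ^ 2 * det2 A) + to_ac (2 * x * y + y ^ 2 * trace2 A) * k =
        to_ac x ^ 2 + 2 * to_ac x * to_ac y * k + to_ac y ^ 2 * k ^ 2"
      unfolding kk by (simp add: algebra_simps)
    also have "\<dots> = to_ac 0 + to_ac 1 * k"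
      using m by (simp add: xy power2_eq_square algebra_simps)
    finally have "x ^ 2 - y ^ 2 * det2 A = 0 \<and> 2 * x * y + y ^ 2 * trace2 A = 1"
      by (rule to_ac_linear_independent[OF kF])
    then have B: "(x \<cdot>\<^sub>m 1\<^sub>m 2 + y \<cdot>\<^sub>m A) ^\<^sub>m 2 = A"
      by (intro pow_mat_2_linear_combination[OF A]) auto
    have "x \<cdot>\<^sub>m 1\<^sub>m 2 + y \<cdot>\<^sub>m A \<in> carrier_mat 2 2"
      using A by simp
    then have "x \<cdot>\<^sub>m 1\<^sub>m 2 + y \<cdot>\<^sub>m A \<in> GL 2"
      using invertible_mat_sqrt[of "x \<cdot>\<^sub>m 1\<^sub>m 2 + y \<cdot>\<^sub>m A" 2] \<open>invertible_mat A\<close>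
      unfolding B GL_def by blast
    with B show "\<exists>B \<in> GL 2. B ^\<^sub>m 2 = A" ..
  qed
qed

end
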